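(* Consider the two-limb CRT-RLWE decryption described in the context, with $\Delta_t=q_2\bmod t$, so that $q_2\Delta_t^{-1}\equiv1\pmod t$. Take a ciphertext with plaintext $M$ and noise polynomial $\nu$ with coefficients $\nu_j$, and add the same integer $\delta$ to the $j$-th coefficient of $c_0$ in both limbs, leaving $c_1$ untouched. (i) While $\nu_j+\delta$ stays below $q_2/2$, the centre lift does not wrap, the two copies of $\delta$ cancel, the plaintext is unchanged, and the inner authenticated payload verifies. As soon as the boundary is crossed, the lift subtracts $q_2$, the $j$-th plaintext coefficient moves by exactly one (modulo $t$), and verification fails. The accept bit is therefore the monotone predicate $$O_j(\delta)=\bigl[\,\delta<\lfloor q_2/2\rfloor+1-\nu_j\,\bigr].$$ (ii) Binary search on $O_j$ returns $\nu_j$ exactly. (iii) Once the whole noise polynomial is known, the relation $c_{1,q_2}s=c_{0,q_2}-\nu$ modulo $q_2$ returns the secret $s$ modulo $q_2$ wherever $c_{1,q_2}$ is a unit; since the secret is small, centre-lifting its residue gives the integer polynomial $s$, and with it the other limb. (iv) At $q_2<2^{32}$ and $n=4096$ this takes at most $4096\cdot32=131072$ adaptive reactions from a single captured ciphertext. (v) In the scalar example $t=7$, $q_2=11$, $\Delta_t=4$, $s=2$, $M=5$, $\nu=1$, the first rejecting shift is $\delta=5$, which returns $\nu=1$ and then $s=2$. On a negacyclic ring with $n=64$ and a $31$-bit $q_2$, an executed run of the attack recovers every noise coefficient and the secret from the accept bit alone, at $30$ queries per coefficient. The attack is conditional on the recipient's acceptance being observable. It needs only accept versus generic reject, so returning one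 generic failure indication does not prevent it.
   Context: The scheme works in a polynomial ring of degree $n$ (for instance the negacyclic ring $\mathbb Z[x]/(x^n+1)$) with two CRT limbs, modulo $t$ and modulo $q_2$. The secret $s$ is a small polynomial. A ciphertext is $(c_0,c_1)$, with limbs $c_{0,t},c_{1,t}$ modulo $t$ and $c_{0,q_2},c_{1,q_2}$ modulo $q_2$. Decryption computes $v_t=c_{0,t}-c_{1,t}s$ modulo $t$ and $v_{q_2}=c_{0,q_2}-c_{1,q_2}s$ modulo $q_2$. The plaintext is embedded so that it vanishes modulo $q_2$, so $v_{q_2}$ carries only the noise. Decryption centre-lifts $v_{q_2}$ coefficientwise to obtain the exact noise polynomial $\nu$ and returns $M=(v_t-\nu)\Delta_t^{-1}\bmod t$, where $\Delta_t=q_2\bmod t$ is invertible modulo $t$. The plaintext $M$ carries an inner authenticated payload: the recipient accepts when it verifies and rejects otherwise, and $O_j(\delta)$ is the resulting accept bit for the ciphertext shifted by $\delta$ in coefficient $j$. A "reaction" is one observed accept/reject answer.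
   Formalization: The formula for O_j is stated for shifts with -q2 < 2(ν_j+δ) ≤ 3q2 and its monotonicity for 0 ≤ δ ≤ q2, where at most one upward wrap occurs; for arbitrary integers it fails, e.g. δ = t·q2 leaves the ciphertext unchanged and is accepted. *)

theory Defs
  imports
    "HOL-Computational_Algebra.Computational_Algebra"
    "HOL-Number_Theory.Cong"
    "HOL-Number_Theory.Modular_Inverse"
begin

definition ring_modulus :: "int poly \<Rightarrow> nat \<Rightarrow> bool" where
  "ring_modulus f n \<longleftrightarrow> lead_coeff f = 1 \<and> degree f = n \<and> 0 < n"

definition negacyclic :: "nat \<Rightarrow> int poly" where
  "negacyclic n = monom 1 n + 1"

text \<open>Canonical representative of the class of \<open>p\<close> in Z[x]/(f, m): degree below \<open>degree f\<close>,
  coefficients in \<open>{0..<m}\<close>. For monic \<open>f\<close>, \<^const>\<open>pseudo_mod\<close> is the ordinary remainder.\<close>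
definition reduce :: "int poly \<Rightarrow> int \<Rightarrow> int poly \<Rightarrow> int poly" where
  "reduce f m p = map_poly (\<lambda>a. a mod m) (pseudo_mod p f)"

definition ring_cong :: "int poly \<Rightarrow> int \<Rightarrow> int poly \<Rightarrow> int poly \<Rightarrow> bool" where
  "ring_cong f m p r \<longleftrightarrow> reduce f m p = reduce f m r"

definition ring_unit :: "int poly \<Rightarrow> int \<Rightarrow> int poly \<Rightarrow> bool" where
  "ring_unit f m p \<longleftrightarrow> (\<exists>u. ring_cong f m (u * p) 1)"

definition ring_inverse :: "int poly \<Rightarrow> int \<Rightarrow> int poly \<Rightarrow> int poly" where
  "ring_inverse f m p = (SOME u. ring_cong f m (u * p) 1)"

text \<open>Centred residues lie in the half-open interval from \<open>-q/2\<close> (excluded) to \<open>q/2\<close> (included);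
  for odd \<open>q\<close> the endpoints are not integers.\<close>
definition centre_lift :: "int \<Rightarrow> int \<Rightarrow> int" where
  "centre_lift q a = (if q < 2 * (a mod q) then a mod q - q else a mod q)"

definition centred :: "int poly \<Rightarrow> int \<Rightarrow> int poly \<Rightarrow> bool" where
  "centred f q p \<longleftrightarrow> degree p < degree f \<and> (\<forall>i. - q < 2 * coeff p i \<and> 2 * coeff p i \<le> q)"

datatype ciphertext =
  Ciphertext (c0_t: "int poly") (c1_t: "int poly") (c0_q: "int poly") (c1_q: "int poly")

definition scheme_params :: "int poly \<Rightarrow> nat \<Rightarrow> int \<Rightarrow> int \<Rightarrow> bool" where
  "scheme_params f n t q2 \<longleftrightarrow> ring_modulus f n \<and> 1 < t \<and> 1 < q2 \<and> coprime t q2"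

definition delta_t :: "int \<Rightarrow> int \<Rightarrow> int" where
  "delta_t t q2 = q2 mod t"

definition delta_t_inv :: "int \<Rightarrow> int \<Rightarrow> int" where
  "delta_t_inv t q2 = modular_inverse t (delta_t t q2)"

definition v_t :: "int poly \<Rightarrow> int \<Rightarrow> int poly \<Rightarrow> ciphertext \<Rightarrow> int poly" where
  "v_t f t s c = reduce f t (c0_t c - c1_t c * s)"

definition v_q :: "int poly \<Rightarrow> int \<Rightarrow> int poly \<Rightarrow> ciphertext \<Rightarrow> int poly" where
  "v_q f q2 s c = reduce f q2 (c0_q c - c1_q c * s)"

definition lifted_noise :: "int poly \<Rightarrow> int \<Rightarrow> int poly \<Rightarrow> ciphertext \<Rightarrow> int poly" where
  "lifted_noise f q2 s c = map_poly (centre_lift q2) (v_q f q2 s c)"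

definition decrypt :: "int poly \<Rightarrow> int \<Rightarrow> int \<Rightarrow> int poly \<Rightarrow> ciphertext \<Rightarrow> int poly" where
  "decrypt f t q2 s c =
     reduce f t (smult (delta_t_inv t q2) (v_t f t s c - lifted_noise f q2 s c))"

text \<open>The ciphertext \<open>c\<close> has plaintext \<open>M\<close> and noise \<open>\<nu>\<close> under \<open>s\<close>. The plaintext enters as
  \<open>q2 * M\<close>, which is \<open>\<Delta>\<^sub>t * M\<close> modulo \<open>t\<close> and vanishes modulo \<open>q2\<close>.\<close>
definition carries ::
  "int poly \<Rightarrow> int \<Rightarrow> int \<Rightarrow> int poly \<Rightarrow> ciphertext \<Rightarrow> int poly \<Rightarrow> int poly \<Rightarrow> bool" where
  "carries f t q2 s c M \<nu> \<longleftrightarrow>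
     reduce f t M = M \<and> centred f q2 \<nu> \<and>
     ring_cong f t (c0_t c - c1_t c * s) (smult (delta_t t q2) M + \<nu>) \<and>
     ring_cong f q2 (c0_q c - c1_q c * s) \<nu>"

definition shift :: "int poly \<Rightarrow> int \<Rightarrow> int \<Rightarrow> ciphertext \<Rightarrow> nat \<Rightarrow> int \<Rightarrow> ciphertext" where
  "shift f t q2 c j \<delta> =
     Ciphertext (reduce f t (c0_t c + monom \<delta> j)) (c1_t c)
                (reduce f q2 (c0_q c + monom \<delta> j)) (c1_q c)"

text \<open>There is one generic failure indication, so a reply carries exactly the accept bit.\<close>
datatype reply = Accepted | Failure

definition recipient ::
  "int poly \<Rightarrow> int \<Rightarrow> int \<Rightarrow> int poly \<Rightarrow> (int poly \<Rightarrow> bool) \<Rightarrow> ciphertext \<Rightarrow> reply" where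
  "recipient f t q2 s verify c = (if verify (decrypt f t q2 s c) then Accepted else Failure)"

definition accept_bit ::
  "int poly \<Rightarrow> int \<Rightarrow> int \<Rightarrow> int poly \<Rightarrow> (int poly \<Rightarrow> bool) \<Rightarrow> ciphertext \<Rightarrow> nat \<Rightarrow> int \<Rightarrow> bool" where
  "accept_bit f t q2 s verify c j \<delta> \<longleftrightarrow>
     recipient f t q2 s verify (shift f t q2 c j \<delta>) = Accepted"

text \<open>Deterministic form of the guarantee of the inner authentication: \<open>M\<close> verifies, and an
  alteration of \<open>M\<close> by one in a single coefficient is detected. Other plaintexts are left
  unconstrained; in particular other honestly authenticated ones may verify.\<close>
definition authenticated ::
  "int poly \<Rightarrow> int \<Rightarrow> (int poly \<Rightarrow> bool) \<Rightarrow> int poly \<Rightarrow> bool" where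
  "authenticated f t verify M \<longleftrightarrow>
     verify M \<and> (\<forall>j < degree f. \<not> verify (reduce f t (M + monom 1 j)))"

text \<open>An adaptive strategy submits ciphertexts and may depend on the recipient only through
  the replies; each \<open>Ask\<close> costs one reaction.\<close>
datatype 'a strategy = Done 'a | Ask ciphertext "reply \<Rightarrow> 'a strategy"

primrec result :: "(ciphertext \<Rightarrow> reply) \<Rightarrow> 'a strategy \<Rightarrow> 'a" where
  "result orc (Done a) = a"
| "result orc (Ask c k) = result orc (k (orc c))"

primrec queries :: "(ciphertext \<Rightarrow> reply) \<Rightarrow> 'a strategy \<Rightarrow> ciphertext list" where
  "queries orc (Done a) = []"
| "queries orc (Ask c k) = c # queries orc (k (orc c))"

primrec andthen :: "'a strategy \<Rightarrow> ('a \<Rightarrow> 'b strategy) \<Rightarrow> 'b strategy" where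
  "andthen (Done a) g = g a"
| "andthen (Ask c k) g = Ask c (\<lambda>r. andthen (k r) g)"

text \<open>Binary search in \<open>{lo..hi}\<close> for the least rejected shift.\<close>
function binary_search :: "(int \<Rightarrow> ciphertext) \<Rightarrow> int \<Rightarrow> int \<Rightarrow> int strategy" where
  "binary_search sh lo hi =
     (if hi \<le> lo then Done lo
      else let m = (lo + hi) div 2 in
        Ask (sh m) (\<lambda>r. if r = Accepted then binary_search sh (m + 1) hi
                        else binary_search sh lo m))"
  by pat_completeness auto
termination
  by (relation "Wellfounded.measure (\<lambda>(sh, lo, hi). nat (hi - lo))") auto

text \<open>Since \<open>- q2 < 2 * \<nu>\<^sub>j \<le> q2\<close>, the least rejected shift \<open>q2 div 2 + 1 - \<nu>\<^sub>j\<close> lies in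
  \<open>{1..q2}\<close>.\<close>
definition find_noise :: "int poly \<Rightarrow> int \<Rightarrow> int \<Rightarrow> ciphertext \<Rightarrow> nat \<Rightarrow> int strategy" where
  "find_noise f t q2 c j =
     andthen (binary_search (shift f t q2 c j) 1 q2) (\<lambda>T. Done (q2 div 2 + 1 - T))"

primrec find_noises ::
  "int poly \<Rightarrow> int \<Rightarrow> int \<Rightarrow> ciphertext \<Rightarrow> nat list \<Rightarrow> int list strategy" where
  "find_noises f t q2 c [] = Done []"
| "find_noises f t q2 c (j # js) =
     andthen (find_noise f t q2 c j) (\<lambda>a.
       andthen (find_noises f t q2 c js) (\<lambda>as. Done (a # as)))"

definition secret_residue :: "int poly \<Rightarrow> int \<Rightarrow> ciphertext \<Rightarrow> int poly \<Rightarrow> int poly" where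
  "secret_residue f q2 c \<nu> = reduce f q2 (ring_inverse f q2 (c1_q c) * (c0_q c - \<nu>))"

definition recovered_secret :: "int poly \<Rightarrow> int \<Rightarrow> ciphertext \<Rightarrow> int poly \<Rightarrow> int poly" where
  "recovered_secret f q2 c \<nu> = map_poly (centre_lift q2) (secret_residue f q2 c \<nu>)"

text \<open>The strategy sees only public data and the captured ciphertext; it returns the noise
  polynomial and the secret.\<close>
definition attack ::
  "int poly \<Rightarrow> int \<Rightarrow> int \<Rightarrow> ciphertext \<Rightarrow> (int poly \<times> int poly) strategy" where
  "attack f t q2 c =
     andthen (find_noises f t q2 c [0..<degree f])
       (\<lambda>as. Done (Poly as, recovered_secret f q2 c (Poly as)))"

end

theory Submission
  imports Defs
begin

text \<open>Adding \<open>\<delta>\<close> to both limbs changes the lifted noise by \<open>\<delta>\<close>, or by \<open>\<delta> - q2\<close> once the centre lift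
  wraps; in the difference with the limb modulo \<open>t\<close> the shift cancels, up to the summand \<open>q2\<close> in
  the second case, which \<open>\<Delta>\<^sub>t\<inverse>\<close> turns into \<open>1\<close>. The accept bit therefore compares \<open>\<delta>\<close> with a
  threshold that determines the noise coefficient.

  For the query count of (v), \<open>q2 = 2^30 + 1\<close> works: the halving of an interval with \<open>2^k + 1\<close>
  points leaves such an interval on the left and one with a power of two many points on the
  right, so only the two leftmost thresholds cost more than \<open>k\<close> queries, and these belong to noise
  far outside the range \<open>\<bar>\<nu>\<^sub>j\<bar> \<le> q2 / 4\<close>.\<close>

section \<open>Arithmetic in the quotient ring\<close>

text \<open>Degrees add in products over the integers. The consequence used below is uniqueness of
  remainders modulo \<open>f\<close>.\<close>

lemma monic_mult_degree_less:
  assumes "ring_modulus f n" "degree (f * a) < n"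
  shows "a = 0"
proof (rule ccontr)
  assume "a \<noteq> 0"
  moreover have "f \<noteq> 0"
    using assms(1) by (auto simp: ring_modulus_def)
  ultimately have "degree (f * a) = degree f + degree a"
    by (simp add: degree_mult_eq)
  with assms show False
    by (simp add: ring_modulus_def)
qed

text \<open>Pseudo-division scales the dividend by a power of the leading coefficient; for monic
  \<open>f\<close> this factor is 1 and ordinary division results.\<close>

lemma pseudo_mod_monic:
  assumes "ring_modulus f n"
  obtains a where "p = f * a + pseudo_mod p f" "degree (pseudo_mod p f) < n"
proof -
  have f: "f \<noteq> 0" "lead_coeff f = 1" "degree f = n" "0 < n"
    using assms by (auto simp: ring_modulus_def)
  obtain a r where d: "pseudo_divmod p f = (a, r)"
    by (cases "pseudo_divmod p f")
  have "p = f * a + r" "r = 0 \<or> degree r < degree f"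
    using pseudo_divmod[OF f(1) d] f(2) by simp_all
  moreover have "pseudo_mod p f = r"
    by (simp add: pseudo_mod_def d)
  ultimately show ?thesis
    using that f by auto
qed

lemma degree_reduce:
  assumes "ring_modulus f n"
  shows "degree (reduce f m p) < n"
proof -
  have "degree (reduce f m p) \<le> degree (pseudo_mod p f)"
    by (rule degree_le) (simp add: reduce_def coeff_map_poly coeff_eq_0)
  with pseudo_mod_monic[OF assms, of p] show ?thesis
    by (meson le_less_trans)
qed

lemma coeff_reduce: "coeff (reduce f m p) i = coeff (pseudo_mod p f) i mod m"
  by (simp add: reduce_def coeff_map_poly)

text \<open>Passes from canonical representatives to membership in the ideal generated by
  \<open>f\<close> and \<open>m\<close>, so that congruence rules reduce to combining
  witnesses.\<close>

lemma ring_cong_iff: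
  assumes "ring_modulus f n"
  shows "ring_cong f m p r \<longleftrightarrow> (\<exists>a b. p - r = f * a + smult m b)"
proof -
  obtain a where a: "p = f * a + pseudo_mod p f" "degree (pseudo_mod p f) < n"
    by (rule pseudo_mod_monic[OF assms])
  obtain b where b: "r = f * b + pseudo_mod r f" "degree (pseudo_mod r f) < n"
    by (rule pseudo_mod_monic[OF assms])
  define u where "u = pseudo_mod p f"
  define v where "v = pseudo_mod r f"
  have pr: "p - r = f * (a - b) + (u - v)"
    using a(1) b(1) unfolding u_def v_def by (simp add: algebra_simps)
  have cong: "ring_cong f m p r \<longleftrightarrow> (\<exists>w. u - v = smult m w)"
  proof -
    have "ring_cong f m p r \<longleftrightarrow> (\<forall>i. m dvd coeff (u - v) i)"
      by (simp add: ring_cong_def poly_eq_iff coeff_reduce u_def v_def mod_eq_dvd_iff)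
    also have "\<dots> \<longleftrightarrow> (\<exists>w. u - v = smult m w)"
      using const_poly_dvd_iff[of m "u - v"] by (simp add: dvd_def)
    finally show ?thesis .
  qed
  show ?thesis
  proof
    assume "ring_cong f m p r"
    then show "\<exists>a b. p - r = f * a + smult m b"
      using cong pr by metis
  next
    assume "\<exists>a b. p - r = f * a + smult m b"
    then obtain x y where xy: "p - r = f * x + smult m y"
      by blast
    \<comment> \<open>The cofactor \<open>y\<close> may have any degree; its own multiple of
      \<open>f\<close> is moved into the first summand, leaving a remainder of degree below
      \<open>n\<close>.\<close>
    obtain z where z: "y = f * z + pseudo_mod y f" "degree (pseudo_mod y f) < n"
      by (rule pseudo_mod_monic[OF assms])
    define w where "w = pseudo_mod y f"
    have "smult m y = f * smult m z + smult m w"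
      using arg_cong[OF z(1), of "smult m"] by (simp add: smult_add_right w_def)
    then have eq: "f * (x + smult m z - (a - b)) = u - v - smult m w"
      using xy pr by (simp add: algebra_simps)
    have "degree (u - v - smult m w) < n"
      using a(2) b(2) z(2) unfolding u_def v_def w_def
      by (intro degree_diff_less) (auto intro: le_less_trans[OF degree_smult_le])
    then have "x + smult m z - (a - b) = 0"
      using monic_mult_degree_less[OF assms] eq by metis
    then have "u - v = smult m w"
      using eq by (metis eq_iff_diff_eq_0 mult_zero_right)
    then show "ring_cong f m p r"
      using cong by blast
  qed
qed

lemma ring_cong_refl [simp]: "ring_cong f m p p"
  by (simp add: ring_cong_def)

lemma ring_cong_sym: "ring_cong f m p r \<Longrightarrow> ring_cong f m r p"
  by (simp add: ring_cong_def)

lemma ring_cong_trans [trans]: "ring_cong f m p r \<Longrightarrow> ring_cong f m r u \<Longrightarrow> ring_cong f m p u"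
  by (simp add: ring_cong_def)

lemma ring_cong_add:
  assumes "ring_modulus f n" "ring_cong f m p r" "ring_cong f m p' r'"
  shows "ring_cong f m (p + p') (r + r')"
proof -
  obtain a b a' b' where "p - r = f * a + smult m b" "p' - r' = f * a' + smult m b'"
    using assms ring_cong_iff[OF assms(1)] by metis
  then have "p + p' - (r + r') = f * (a + a') + smult m (b + b')"
    by (simp add: algebra_simps smult_add_right)
  then show ?thesis
    using ring_cong_iff[OF assms(1)] by blast
qed

lemma ring_cong_mult_left:
  assumes "ring_modulus f n" "ring_cong f m p r"
  shows "ring_cong f m (u * p) (u * r)"
proof -
  obtain a b where "p - r = f * a + smult m b"
    using assms ring_cong_iff[OF assms(1)] by metis
  then have "u * p - u * r = f * (u * a) + smult m (u * b)"
    by (metis distrib_left mult.left_commute mult_smult_right right_diff_distrib)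
  then show ?thesis
    using ring_cong_iff[OF assms(1)] by blast
qed

lemma ring_cong_smult:
  assumes "ring_modulus f n" "ring_cong f m p r"
  shows "ring_cong f m (smult k p) (smult k r)"
  using ring_cong_mult_left[OF assms, of "[:k:]"] by simp

lemma ring_cong_diff:
  assumes "ring_modulus f n" "ring_cong f m p r" "ring_cong f m p' r'"
  shows "ring_cong f m (p - p') (r - r')"
  using ring_cong_add[OF assms(1,2) ring_cong_smult[OF assms(1,3), of "-1"]] by simp

text \<open>Serves to trade \<open>delta_t t q2\<close> for \<open>q2\<close>,
  \<open>q2 * delta_t_inv t q2\<close> for 1, and a shift for its wrapped form.\<close>

lemma ring_cong_smult_cong:
  assumes "ring_modulus f n" "[k = k'] (mod m)"
  shows "ring_cong f m (smult k p) (smult k' p)"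
proof -
  obtain l where "k - k' = m * l"
    using assms(2) by (auto simp: cong_iff_dvd_diff)
  then have "smult k p - smult k' p = f * 0 + smult m (smult l p)"
    by (simp flip: smult_diff_left)
  then show ?thesis
    using ring_cong_iff[OF assms(1)] by blast
qed

lemma pseudo_mod_small:
  assumes "ring_modulus f n" "degree p < n"
  shows "pseudo_mod p f = p"
proof -
  obtain a where a: "p = f * a + pseudo_mod p f" "degree (pseudo_mod p f) < n"
    by (rule pseudo_mod_monic[OF assms(1)])
  then have "f * a = p - pseudo_mod p f"
    by (simp add: algebra_simps)
  moreover have "degree (p - pseudo_mod p f) < n"
    using a(2) assms(2) by (rule degree_diff_less[rotated])
  ultimately have "a = 0"
    using monic_mult_degree_less[OF assms(1)] by metis
  with a(1) show ?thesis
    by simp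
qed

lemma coeff_reduce_small:
  assumes "ring_modulus f n" "degree p < n"
  shows "coeff (reduce f m p) i = coeff p i mod m"
  by (simp add: coeff_reduce pseudo_mod_small[OF assms])

lemma ring_cong_reduce:
  assumes "ring_modulus f n"
  shows "ring_cong f m (reduce f m p) p"
proof -
  have "coeff (reduce f m (reduce f m p)) i = coeff (reduce f m p) i" for i
    by (simp only: coeff_reduce_small[OF assms degree_reduce[OF assms]])
       (simp add: coeff_reduce)
  then show ?thesis
    by (simp add: ring_cong_def poly_eq_iff)
qed

section \<open>Centred residues\<close>

lemma centre_lift_mod:
  assumes "- q < 2 * x" "2 * x \<le> q"
  shows "centre_lift q (x mod q) = x"
proof (cases "x < 0")
  case True
  \<comment> \<open>The double of \<open>x + q\<close> exceeds \<open>q\<close> because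
    \<open>- q < 2 * x\<close>, so the lift subtracts \<open>q\<close> again.\<close>
  then have "x mod q = x + q"
    using assms by (intro int_mod_pos_eq[of _ _ "-1"]) auto
  with True assms show ?thesis
    by (simp add: centre_lift_def)
next
  case False
  then have "x mod q = x"
    using assms by (cases "x = 0") auto
  with False assms show ?thesis
    by (simp add: centre_lift_def)
qed

text \<open>A residue class has at most one centred representative. Both the noise and the secret
  are recovered this way.\<close>

lemma centre_lift_reduce:
  assumes "ring_modulus f n" "centred f q x" "ring_cong f q p x"
  shows "map_poly (centre_lift q) (reduce f q p) = x"
proof (rule poly_eqI)
  fix i
  have x: "degree x < n" "- q < 2 * coeff x i" "2 * coeff x i \<le> q"
    using assms(1,2) by (auto simp: centred_def ring_modulus_def)
  \<comment> \<open>\<open>map_poly\<close> acts coefficientwise for functions that fix 0, the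
    default coefficient.\<close>
  have "centre_lift q 0 = 0"
    using centre_lift_mod[of q 0] x by simp
  then have "coeff (map_poly (centre_lift q) (reduce f q p)) i
      = centre_lift q (coeff (reduce f q p) i)"
    by (simp add: coeff_map_poly)
  also have "\<dots> = centre_lift q (coeff x i mod q)"
    using assms(3) by (simp add: ring_cong_def coeff_reduce_small[OF assms(1) x(1)])
  also have "\<dots> = coeff x i"
    using x by (intro centre_lift_mod)
  finally show "coeff (map_poly (centre_lift q) (reduce f q p)) i = coeff x i" .
qed

section \<open>Adaptive strategies\<close>

lemma result_andthen [simp]: "result orc (andthen p g) = result orc (g (result orc p))"
  by (induction p) simp_all

lemma queries_andthen [simp]:
  "queries orc (andthen p g) = queries orc p @ queries orc (g (result orc p))"
  by (induction p) simp_all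

declare binary_search.simps [simp del]

text \<open>The invariant is that the threshold stays in the current interval. A midpoint is always
  below \<open>hi\<close>, which explains the range of \<open>m\<close> in the last premise.\<close>

lemma result_binary_search:
  assumes "lo \<le> T" "T \<le> hi"
    and "\<And>m. lo \<le> m \<Longrightarrow> m < hi \<Longrightarrow> orc (sh m) = Accepted \<longleftrightarrow> m < T"
  shows "result orc (binary_search sh lo hi) = T"
  using assms
proof (induction sh lo hi rule: binary_search.induct)
  case (1 sh lo hi)
  define m where "m = (lo + hi) div 2"
  show ?case
  proof (cases "hi \<le> lo")
    case True
    with "1.prems" show ?thesis
      by (subst binary_search.simps) simp
  next
    case False
    then have m: "lo \<le> m" "m < hi"
      unfolding m_def by auto
    show ?thesis
    proof (cases "m < T")
      case True
      then have acc: "orc (sh m) = Accepted"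
        using "1.prems"(3) m by simp
      have "result orc (binary_search sh (m + 1) hi) = T"
        using True m "1.prems" by (intro "1.IH"(1)[OF False m_def]) auto
      with False acc show ?thesis
        by (subst binary_search.simps) (simp flip: m_def)
    next
      case ge: False
      then have rej: "orc (sh m) \<noteq> Accepted"
        using "1.prems"(3) m by simp
      have "result orc (binary_search sh lo m) = T"
        using ge m rej "1.prems" by (intro "1.IH"(2)[OF False m_def]) auto
      with False rej show ?thesis
        by (subst binary_search.simps) (simp flip: m_def)
    qed
  qed
qed

section \<open>Query counts of the binary search\<close>

lemma length_queries_binary_search_le:
  "hi - lo < 2 ^ k \<Longrightarrow> length (queries orc (binary_search sh lo hi)) \<le> k"
proof (induction k arbitrary: lo hi)
  case 0
  then show ?case
    by (subst binary_search.simps) simp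
next
  case (Suc k)
  define m where "m = (lo + hi) div 2"
  \<comment> \<open>At most \<open>2 ^ Suc k\<close> points split into halves of at most
    \<open>2 ^ k\<close>, whatever the oracle replies.\<close>
  have "hi - (m + 1) < 2 ^ k" "m - lo < 2 ^ k"
    using Suc.prems unfolding m_def by auto
  with Suc.IH show ?case
    by (subst binary_search.simps) (simp flip: m_def)
qed

text \<open>A power-of-two interval splits evenly at every stage, so the count does not depend on
  the replies.\<close>

lemma length_queries_binary_search_power:
  "hi - lo + 1 = 2 ^ k \<Longrightarrow> length (queries orc (binary_search sh lo hi)) = k"
proof (induction k arbitrary: lo hi)
  case 0
  then show ?case
    by (subst binary_search.simps) simp
next
  case (Suc k)
  define m where "m = (lo + hi) div 2"
  have pos: "(1 :: int) \<le> 2 ^ k"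
    by simp
  have "hi = lo + 2 * 2 ^ k - 1"
    using Suc.prems by simp
  then have "m = lo + 2 ^ k - 1"
    unfolding m_def by simp
  then have "hi - (m + 1) + 1 = 2 ^ k" "m - lo + 1 = 2 ^ k" "\<not> hi \<le> lo"
    using \<open>hi = _\<close> pos by linarith+
  with Suc.IH show ?case
    by (subst binary_search.simps) (simp flip: m_def)
qed

text \<open>The surplus point always falls into the left half. A threshold of at least
  \<open>lo + 2\<close> leaves the left branch before a two-point interval would cost an extra
  query.\<close>

lemma length_queries_binary_search_power_Suc:
  assumes "hi - lo = 2 ^ k" "lo + 2 \<le> T" "T \<le> hi"
    and "\<And>m. lo \<le> m \<Longrightarrow> m < hi \<Longrightarrow> orc (sh m) = Accepted \<longleftrightarrow> m < T"
  shows "length (queries orc (binary_search sh lo hi)) = k"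
  using assms
proof (induction k arbitrary: hi)
  case 0
  \<comment> \<open>Here \<open>hi = lo + 1\<close>, which contradicts \<open>lo + 2 \<le> T\<close>
    and \<open>T \<le> hi\<close>.\<close>
  then show ?case
    by simp
next
  case (Suc k)
  define m where "m = (lo + hi) div 2"
  have pos: "(1 :: int) \<le> 2 ^ k"
    by simp
  have hi: "hi = lo + 2 * 2 ^ k"
    using Suc.prems(1) by simp
  have m: "m = lo + 2 ^ k"
    unfolding m_def hi by simp
  have acc: "orc (sh m) = Accepted \<longleftrightarrow> m < T"
    using Suc.prems(4) hi m pos by simp
  show ?case
  proof (cases "m < T")
    case True
    have "length (queries orc (binary_search sh (m + 1) hi)) = k"
      by (rule length_queries_binary_search_power) (use hi m in simp)
    moreover have "\<not> hi \<le> lo"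
      using hi pos by linarith
    ultimately show ?thesis
      using True acc by (subst binary_search.simps) (simp flip: m_def)
  next
    case False
    have "length (queries orc (binary_search sh lo m)) = k"
      using Suc.prems False hi m pos by (intro Suc.IH) auto
    moreover have "\<not> hi \<le> lo"
      using hi pos by linarith
    ultimately show ?thesis
      using False acc by (subst binary_search.simps) (simp flip: m_def)
  qed
qed

text \<open>Needed for the claim that every reaction concerns a shift of the one captured
  ciphertext.\<close>

lemma set_queries_binary_search: "set (queries orc (binary_search sh lo hi)) \<subseteq> range sh"
proof (induction sh lo hi rule: binary_search.induct)
  case (1 sh lo hi)
  then show ?case
    by (subst binary_search.simps) (auto simp: Let_def)
qed

section \<open>Independent searches for all coefficients\<close>

lemma result_find_noises:
  "result orc (find_noises f t q2 c js) = map (\<lambda>j. result orc (find_noise f t q2 c j)) js"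
  by (induction js) simp_all

lemma queries_find_noises:
  "queries orc (find_noises f t q2 c js) =
     concat (map (\<lambda>j. queries orc (find_noise f t q2 c j)) js)"
  by (induction js) simp_all

lemma queries_attack:
  "queries orc (attack f t q2 c) =
     concat (map (\<lambda>j. queries orc (find_noise f t q2 c j)) [0..<degree f])"
  by (simp add: attack_def queries_find_noises)

lemma length_concat_map_le:
  assumes "\<And>x. x \<in> set xs \<Longrightarrow> length (g x) \<le> k"
  shows "length (concat (map g xs)) \<le> length xs * k"
  using assms by (induction xs) (simp_all add: add_mono)

lemma length_concat_map_eq:
  assumes "\<And>x. x \<in> set xs \<Longrightarrow> length (g x) = k"
  shows "length (concat (map g xs)) = length xs * k"
  using assms by (induction xs) simp_all

lemma queries_find_noise:
  "queries orc (find_noise f t q2 c j) = queries orc (binary_search (shift f t q2 c j) 1 q2)"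
  by (simp add: find_noise_def)

section \<open>The decryption oracle\<close>

text \<open>Coprimality passes from \<open>q2\<close> to its residue \<open>delta_t t q2\<close>,
  which modulo \<open>t\<close> is interchangeable with \<open>q2\<close>.\<close>

lemma mult_delta_t_inv:
  assumes "scheme_params f n t q2"
  shows "[q2 * delta_t_inv t q2 = 1] (mod t)"
proof -
  have "coprime (delta_t t q2) t"
    using assms by (simp add: scheme_params_def delta_t_def coprime_commute)
  then have "[delta_t_inv t q2 * delta_t t q2 = 1] (mod t)"
    unfolding delta_t_inv_def by (rule cong_modular_inverse2)
  then show ?thesis
    by (simp add: cong_def delta_t_def mult.commute mod_mult_right_eq)
qed

text \<open>Here \<open>x\<close> is the noise that decryption removes and \<open>smult q2 B\<close>
  is what the limb modulo \<open>t\<close> holds beyond it; the final scaling turns this surplus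
  into \<open>B\<close>. The cases used are \<open>B = 0\<close> without a wrap and
  \<open>B = monom 1 j\<close> after one.\<close>

lemma decrypt_eq:
  assumes params: "scheme_params f n t q2"
    and "ring_cong f t (c0_t e - c1_t e * s) (smult (delta_t t q2) M + x + smult q2 B)"
    and "lifted_noise f q2 s e = x"
  shows "decrypt f t q2 s e = reduce f t (M + B)"
proof -
  have f: "ring_modulus f n"
    using params by (simp add: scheme_params_def)
  let ?i = "delta_t_inv t q2"
  have "ring_cong f t (v_t f t s e) (smult (delta_t t q2) M + x + smult q2 B)"
    unfolding v_t_def by (rule ring_cong_trans[OF ring_cong_reduce[OF f] assms(2)])
  from ring_cong_diff[OF f this ring_cong_refl[of _ _ x]]
  have "ring_cong f t (v_t f t s e - x) (smult (delta_t t q2) M + smult q2 B)"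
    by simp
  \<comment> \<open>\<open>delta_t t q2\<close> and \<open>q2\<close> agree modulo \<open>t\<close>,
    so \<open>q2\<close> becomes a common factor of plaintext and surplus.\<close>
  also have "ring_cong f t \<dots> (smult q2 M + smult q2 B)"
    by (intro ring_cong_add[OF f] ring_cong_smult_cong[OF f])
       (simp_all add: delta_t_def cong_def)
  finally have "ring_cong f t (smult ?i (v_t f t s e - x)) (smult ?i (smult q2 M + smult q2 B))"
    by (rule ring_cong_smult[OF f])
  also have "smult ?i (smult q2 M + smult q2 B) = smult (q2 * ?i) (M + B)"
    by (simp add: smult_add_right mult.commute)
  also have "ring_cong f t \<dots> (smult 1 (M + B))"
    by (rule ring_cong_smult_cong[OF f mult_delta_t_inv[OF params]])
  finally show ?thesis
    by (simp add: decrypt_def assms(3) ring_cong_def)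
qed

text \<open>Shows that the hypotheses of the numerical examples can be met, so their claims are not
  vacuous.\<close>

lemma exists_captured_ciphertext:
  assumes params: "scheme_params f n t q2"
    and m: "reduce f t m = m" and \<mu>: "centred f q2 \<mu>"
  obtains d V where "carries f t q2 s d m \<mu>" "authenticated f t V m" "ring_unit f q2 (c1_q d)"
proof
  have f: "ring_modulus f n" and t: "1 < t"
    using params by (simp_all add: scheme_params_def)
  \<comment> \<open>With \<open>c1\<close> equal to 1 the unit condition is immediate, and
    \<open>c0\<close> is the secret plus the wanted payload.\<close>
  let ?d = "Ciphertext (s + smult (delta_t t q2) m + \<mu>) 1 (s + \<mu>) 1"
  show "carries f t q2 s ?d m \<mu>"
    using m \<mu> by (simp add: carries_def)
  show "ring_unit f q2 (c1_q ?d)"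
    by (auto simp: ring_unit_def intro: exI[of _ 1])
  \<comment> \<open>The verifier will accept only \<open>m\<close>; adding 1 to a coefficient
    changes its residue since \<open>t > 1\<close>.\<close>
  have "reduce f t (m + monom 1 j) \<noteq> m" if "j < degree f" for j
  proof
    assume eq: "reduce f t (m + monom 1 j) = m"
    have "degree m < n"
      using degree_reduce[OF f, of t m] m by simp
    moreover have "degree (monom (1 :: int) j) < n"
      using that f by (simp add: ring_modulus_def degree_monom_eq)
    ultimately have "degree (m + monom 1 j) < n"
      by (rule degree_add_less)
    from coeff_reduce_small[OF f this, of t j] eq
    have "(coeff m j + 1) mod t = coeff m j mod t"
      by (metis coeff_add coeff_monom mod_mod_trivial)
    then show False
      using t by (simp add: mod_eq_dvd_iff)
  qed
  then show "authenticated f t (\<lambda>x. x = m) m"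
    by (simp add: authenticated_def)
qed

text \<open>Collects the hypotheses so that the results apply to the general ciphertext and again to
  both numerical examples.\<close>

locale captured_ciphertext =
  fixes f s M \<nu> :: "int poly" and n :: nat and t q2 :: int
    and c :: ciphertext and verify :: "int poly \<Rightarrow> bool"
  assumes params: "scheme_params f n t q2"
    and small: "centred f q2 s"
    and carries: "carries f t q2 s c M \<nu>"
    and auth: "authenticated f t verify M"
begin

lemma modulus: "ring_modulus f n"
  and degree_modulus: "degree f = n"
  using params by (auto simp: scheme_params_def ring_modulus_def)

lemma noise_bounds: "- q2 < 2 * coeff \<nu> j" "2 * coeff \<nu> j \<le> q2"
  and degree_noise: "degree \<nu> < n"
  using carries degree_modulus by (auto simp: carries_def centred_def)

lemma cong_t: "ring_cong f t (c0_t c - c1_t c * s) (smult (delta_t t q2) M + \<nu>)"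
  and cong_q: "ring_cong f q2 (c0_q c - c1_q c * s) \<nu>"
  and reduce_plaintext: "reduce f t M = M"
  using carries by (simp_all add: carries_def)

lemma degree_plaintext: "degree M < n"
  using degree_reduce[OF modulus, of t M] reduce_plaintext by simp

lemma lifted_noise_eq: "lifted_noise f q2 s c = \<nu>"
  unfolding lifted_noise_def v_q_def
  using carries by (intro centre_lift_reduce[OF modulus]) (simp_all add: carries_def)

lemma decrypt_captured: "decrypt f t q2 s c = M"
  using decrypt_eq[OF params, where B = 0] cong_t lifted_noise_eq reduce_plaintext by simp

section \<open>Effect of a shift on limbs, lift and accept bit\<close>

lemma shift_cong_t:
  "ring_cong f t (c0_t (shift f t q2 c j \<delta>) - c1_t (shift f t q2 c j \<delta>) * s)
     (smult (delta_t t q2) M + \<nu> + monom \<delta> j)"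
proof -
  \<comment> \<open>The reduction in \<open>shift\<close> stays within the class and
    \<open>c1\<close> is untouched, so \<open>\<delta>\<close> enters additively.\<close>
  have "ring_cong f t (reduce f t (c0_t c + monom \<delta> j) - c1_t c * s)
      (c0_t c + monom \<delta> j - c1_t c * s)"
    by (intro ring_cong_diff[OF modulus] ring_cong_reduce[OF modulus] ring_cong_refl)
  also have "c0_t c + monom \<delta> j - c1_t c * s = c0_t c - c1_t c * s + monom \<delta> j"
    by simp
  also have "ring_cong f t \<dots> (smult (delta_t t q2) M + \<nu> + monom \<delta> j)"
    by (intro ring_cong_add[OF modulus] cong_t ring_cong_refl)
  finally show ?thesis
    by (simp add: shift_def)
qed

lemma shift_cong_q:
  "ring_cong f q2 (c0_q (shift f t q2 c j \<delta>) - c1_q (shift f t q2 c j \<delta>) * s) (\<nu> + monom \<delta> j)"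
proof -
  have "ring_cong f q2 (reduce f q2 (c0_q c + monom \<delta> j) - c1_q c * s)
      (c0_q c + monom \<delta> j - c1_q c * s)"
    by (intro ring_cong_diff[OF modulus] ring_cong_reduce[OF modulus] ring_cong_refl)
  also have "c0_q c + monom \<delta> j - c1_q c * s = c0_q c - c1_q c * s + monom \<delta> j"
    by simp
  also have "ring_cong f q2 \<dots> (\<nu> + monom \<delta> j)"
    by (intro ring_cong_add[OF modulus] cong_q ring_cong_refl)
  finally show ?thesis
    by (simp add: shift_def)
qed

text \<open>Handles both sides of the boundary: \<open>\<epsilon>\<close> is the representative of
  \<open>\<delta>\<close> that keeps the coefficient centred, namely \<open>\<delta>\<close> without
  a wrap and \<open>\<delta> - q2\<close> after one.\<close>

lemma lifted_noise_shift:
  assumes "j < n" "[\<delta> = \<epsilon>] (mod q2)" "- q2 < 2 * (coeff \<nu> j + \<epsilon>)" "2 * (coeff \<nu> j + \<epsilon>) \<le> q2"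
  shows "lifted_noise f q2 s (shift f t q2 c j \<delta>) = \<nu> + monom \<epsilon> j"
  unfolding lifted_noise_def v_q_def
proof (rule centre_lift_reduce[OF modulus])
  have "degree (monom \<epsilon> j) < n"
    using assms(1) by (intro le_less_trans[OF degree_monom_le])
  then show "centred f q2 (\<nu> + monom \<epsilon> j)"
    using assms noise_bounds degree_noise
    by (auto simp: centred_def degree_modulus intro!: degree_add_less)
  have "ring_cong f q2 (smult \<delta> (monom 1 j)) (smult \<epsilon> (monom 1 j))"
    by (rule ring_cong_smult_cong[OF modulus assms(2)])
  then have "ring_cong f q2 (\<nu> + monom \<delta> j) (\<nu> + monom \<epsilon> j)"
    by (intro ring_cong_add[OF modulus]) (simp_all add: smult_monom)
  with shift_cong_q show "ring_cong f q2
      (c0_q (shift f t q2 c j \<delta>) - c1_q (shift f t q2 c j \<delta>) * s) (\<nu> + monom \<epsilon> j)"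
    by (rule ring_cong_trans)
qed

context
  fixes j :: nat and \<delta> :: int
  assumes j: "j < n"
    and below: "- q2 < 2 * (coeff \<nu> j + \<delta>)" "coeff \<nu> j + \<delta> \<le> q2 div 2"
begin

text \<open>Takes \<open>\<epsilon> = \<delta>\<close>. For an integer \<open>x\<close>, the bound
  \<open>x \<le> q2 div 2\<close> amounts to \<open>2 * x \<le> q2\<close>.\<close>

lemma lifted_noise_below: "lifted_noise f q2 s (shift f t q2 c j \<delta>) = \<nu> + monom \<delta> j"
  using below by (intro lifted_noise_shift[OF j]) auto

text \<open>The limb modulo \<open>t\<close> and the lifted noise contain the same
  \<open>monom \<delta> j\<close>, so both differences are congruent to
  \<open>smult (delta_t t q2) M\<close>.\<close>

lemma shift_cancels_below:
  "ring_cong f t (v_t f t s (shift f t q2 c j \<delta>) - lifted_noise f q2 s (shift f t q2 c j \<delta>))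
     (v_t f t s c - lifted_noise f q2 s c)"
proof -
  have "ring_cong f t (v_t f t s (shift f t q2 c j \<delta>) - (\<nu> + monom \<delta> j))
      (smult (delta_t t q2) M + \<nu> + monom \<delta> j - (\<nu> + monom \<delta> j))"
    unfolding v_t_def
    by (intro ring_cong_diff[OF modulus] ring_cong_refl
        ring_cong_trans[OF ring_cong_reduce[OF modulus] shift_cong_t])
  moreover have "ring_cong f t (v_t f t s c - \<nu>) (smult (delta_t t q2) M + \<nu> - \<nu>)"
    unfolding v_t_def
    by (intro ring_cong_diff[OF modulus] ring_cong_refl
        ring_cong_trans[OF ring_cong_reduce[OF modulus] cong_t])
  ultimately show ?thesis
    unfolding lifted_noise_below lifted_noise_eq by (simp add: ring_cong_def)
qed

lemma decrypt_below: "decrypt f t q2 s (shift f t q2 c j \<delta>) = M"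
  using decrypt_eq[OF params _ lifted_noise_below, where B = 0 and M = M] shift_cong_t
    reduce_plaintext by (simp add: add.assoc)

lemma accept_below: "accept_bit f t q2 s verify c j \<delta>"
  using auth by (simp add: accept_bit_def recipient_def decrypt_below authenticated_def)

end

context
  fixes j :: nat and \<delta> :: int
  assumes j: "j < n"
    and above: "q2 div 2 < coeff \<nu> j + \<delta>" "2 * (coeff \<nu> j + \<delta>) \<le> 3 * q2"
begin

text \<open>Takes \<open>\<epsilon> = \<delta> - q2\<close>. The bound by \<open>3 * q2\<close>
  ensures that one subtraction of \<open>q2\<close> centres the coefficient.\<close>

lemma lifted_noise_above: "lifted_noise f q2 s (shift f t q2 c j \<delta>) = \<nu> + monom (\<delta> - q2) j"
  using above by (intro lifted_noise_shift[OF j]) (auto simp: cong_iff_dvd_diff)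

lemma decrypt_above: "decrypt f t q2 s (shift f t q2 c j \<delta>) = reduce f t (M + monom 1 j)"
proof (rule decrypt_eq[OF params _ lifted_noise_above])
  \<comment> \<open>The limb modulo \<open>t\<close> still holds all of \<open>\<delta>\<close>, the
    lift only \<open>\<delta> - q2\<close>; the gap is the surplus with
    \<open>B = monom 1 j\<close>.\<close>
  have "monom \<delta> j = monom (\<delta> - q2) j + smult q2 (monom 1 j)"
    by (simp add: smult_monom add_monom)
  then show "ring_cong f t (c0_t (shift f t q2 c j \<delta>) - c1_t (shift f t q2 c j \<delta>) * s)
      (smult (delta_t t q2) M + (\<nu> + monom (\<delta> - q2) j) + smult q2 (monom 1 j))"
    using shift_cong_t[of j \<delta>] by (simp add: add.assoc)
qed

text \<open>Since \<open>j < n\<close>, the sum is already a remainder modulo \<open>f\<close>, and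
  the coefficients of \<open>M\<close> are reduced modulo \<open>t\<close>.\<close>

lemma coeff_decrypt_above:
  "coeff (decrypt f t q2 s (shift f t q2 c j \<delta>)) i =
     (if i = j then (coeff M j + 1) mod t else coeff M i)"
proof -
  have "degree (M + monom 1 j) < n"
    using j degree_plaintext by (intro degree_add_less) (simp_all add: degree_monom_eq)
  moreover have "coeff M i mod t = coeff M i"
    using coeff_reduce_small[OF modulus degree_plaintext, of t i] reduce_plaintext by simp
  ultimately show ?thesis
    by (simp add: decrypt_above coeff_reduce_small[OF modulus])
qed

lemma reject_above: "\<not> accept_bit f t q2 s verify c j \<delta>"
  using auth j by (simp add: accept_bit_def recipient_def decrypt_above authenticated_def
      degree_modulus)

end

lemma accept_bit_iff:
  assumes "j < n" "- q2 < 2 * (coeff \<nu> j + \<delta>)" "2 * (coeff \<nu> j + \<delta>) \<le> 3 * q2"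
  shows "accept_bit f t q2 s verify c j \<delta> \<longleftrightarrow> \<delta> < q2 div 2 + 1 - coeff \<nu> j"
proof (cases "coeff \<nu> j + \<delta> \<le> q2 div 2")
  case True
  with accept_below[of j \<delta>] assms show ?thesis
    by simp
next
  case False
  with reject_above[of j \<delta>] assms show ?thesis
    by simp
qed

text \<open>For centred noise, shifts from 0 to \<open>q2\<close> wrap at most once. The binary
  search asks only such shifts.\<close>

lemma accept_bit_iff_nonneg:
  assumes "j < n" "0 \<le> \<delta>" "\<delta> \<le> q2"
  shows "accept_bit f t q2 s verify c j \<delta> \<longleftrightarrow> \<delta> < q2 div 2 + 1 - coeff \<nu> j"
  using noise_bounds[of j] assms by (intro accept_bit_iff) auto

section \<open>Recovery of the noise and the secret\<close>

lemma result_find_noise: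
  assumes "j < n"
  shows "result (recipient f t q2 s verify) (find_noise f t q2 c j) = coeff \<nu> j"
proof -
  have "result (recipient f t q2 s verify) (binary_search (shift f t q2 c j) 1 q2)
      = q2 div 2 + 1 - coeff \<nu> j"
    \<comment> \<open>The noise bounds place the threshold in \<open>{1..q2}\<close>, the initial
      search interval.\<close>
    using noise_bounds[of j] assms accept_bit_iff_nonneg[OF assms]
    by (intro result_binary_search) (auto simp flip: accept_bit_def)
  then show ?thesis
    by (simp add: find_noise_def)
qed

lemma secret_relation: "ring_cong f q2 (c1_q c * s) (c0_q c - \<nu>)"
  using ring_cong_diff[OF modulus ring_cong_refl[of _ _ "c0_q c"] cong_q] by simp

lemma secret_residue_cong:
  assumes "ring_unit f q2 (c1_q c)"
  shows "ring_cong f q2 (ring_inverse f q2 (c1_q c) * (c0_q c - \<nu>)) s"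
proof -
  let ?u = "ring_inverse f q2 (c1_q c)"
  \<comment> \<open>The unit hypothesis justifies the choice made in
    \<open>ring_inverse\<close>.\<close>
  have inv: "ring_cong f q2 (?u * c1_q c) 1"
    using assms unfolding ring_unit_def ring_inverse_def by (rule someI_ex)
  have "ring_cong f q2 (?u * (c0_q c - \<nu>)) (?u * (c1_q c * s))"
    by (rule ring_cong_mult_left[OF modulus ring_cong_sym[OF secret_relation]])
  also have "?u * (c1_q c * s) = s * (?u * c1_q c)"
    by (simp add: ac_simps)
  also have "ring_cong f q2 \<dots> (s * 1)"
    by (rule ring_cong_mult_left[OF modulus inv])
  finally show ?thesis
    by simp
qed

lemma secret_residue_eq:
  "ring_unit f q2 (c1_q c) \<Longrightarrow> secret_residue f q2 c \<nu> = reduce f q2 s"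
  using secret_residue_cong by (simp add: secret_residue_def ring_cong_def)

text \<open>Smallness enters here: a centred secret is determined as an integer polynomial by its
  residue, and hence so is its other limb.\<close>

lemma recovered_secret_eq:
  "ring_unit f q2 (c1_q c) \<Longrightarrow> recovered_secret f q2 c \<nu> = s"
  unfolding recovered_secret_def secret_residue_def
  by (rule centre_lift_reduce[OF modulus small secret_residue_cong])

lemma result_attack:
  assumes "ring_unit f q2 (c1_q c)"
  shows "result (recipient f t q2 s verify) (attack f t q2 c) = (\<nu>, s)"
proof -
  have "result (recipient f t q2 s verify) (find_noises f t q2 c [0..<n])
      = map (coeff \<nu>) [0..<n]"
    by (simp add: result_find_noises result_find_noise)
  \<comment> \<open>The degree is below \<open>n\<close>, so the list holds every nonzero
    coefficient; positions past its end read 0.\<close>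
  moreover have "Poly (map (coeff \<nu>) [0..<n]) = \<nu>"
    using degree_noise
    by (intro poly_eqI) (auto simp: coeff_Poly_eq nth_default_def coeff_eq_0)
  ultimately show ?thesis
    by (simp add: attack_def degree_modulus recovered_secret_eq[OF assms])
qed

text \<open>The interval \<open>{1..q2}\<close> has \<open>2 ^ k + 1\<close> points, and the quarter
  bound keeps the threshold away from 1 and 2.\<close>

lemma length_queries_find_noise:
  assumes "j < n" "q2 = 2 ^ k + 1" "4 * \<bar>coeff \<nu> j\<bar> \<le> q2" "3 \<le> k"
  shows "length (queries (recipient f t q2 s verify) (find_noise f t q2 c j)) = k"
  unfolding queries_find_noise
proof (rule length_queries_binary_search_power_Suc)
  \<comment> \<open>Small moduli fail through rounding: with \<open>q2 = 5\<close> and noise 1 the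
    threshold would be 2.\<close>
  have "(2 :: int) ^ 3 \<le> 2 ^ k"
    using assms(4) by (rule power_increasing) simp
  then have "9 \<le> q2"
    using assms(2) by simp
  then show "1 + 2 \<le> q2 div 2 + 1 - coeff \<nu> j" "q2 div 2 + 1 - coeff \<nu> j \<le> q2"
    using assms(3) by linarith+
  show "q2 - 1 = 2 ^ k"
    using assms(2) by simp
  show "recipient f t q2 s verify (shift f t q2 c j m) = Accepted
      \<longleftrightarrow> m < q2 div 2 + 1 - coeff \<nu> j" if "1 \<le> m" "m < q2" for m
    using that accept_bit_iff_nonneg[OF assms(1), of m] by (simp add: accept_bit_def)
qed

end

section \<open>The reaction attack, its query counts and the examples\<close>

theorem mainTheorem8:
  fixes f s M \<nu> :: "int poly" and n :: nat and t q2 :: int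
    and c :: ciphertext and verify :: "int poly \<Rightarrow> bool"
  assumes params: "scheme_params f n t q2"
    and small: "centred f q2 s"
    and carries: "carries f t q2 s c M \<nu>"
    and auth: "authenticated f t verify M"
  shows
    "([q2 * delta_t_inv t q2 = 1] (mod t) \<and>
     lifted_noise f q2 s c = \<nu> \<and> decrypt f t q2 s c = M) \<and>
     \<comment> \<open>(i)\<close>
     (\<forall>j<n. \<forall>\<delta>.
      (- q2 < 2 * (coeff \<nu> j + \<delta>) \<and> coeff \<nu> j + \<delta> \<le> q2 div 2 \<longrightarrow>
         lifted_noise f q2 s (shift f t q2 c j \<delta>) = \<nu> + monom \<delta> j \<and>
         ring_cong f t (v_t f t s (shift f t q2 c j \<delta>) - lifted_noise f q2 s (shift f t q2 c j \<delta>))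
                       (v_t f t s c - lifted_noise f q2 s c) \<and>
         decrypt f t q2 s (shift f t q2 c j \<delta>) = M \<and>
         accept_bit f t q2 s verify c j \<delta>) \<and>
      (q2 div 2 < coeff \<nu> j + \<delta> \<and> 2 * (coeff \<nu> j + \<delta>) \<le> 3 * q2 \<longrightarrow>
         lifted_noise f q2 s (shift f t q2 c j \<delta>) = \<nu> + monom (\<delta> - q2) j \<and>
         (\<forall>i. coeff (decrypt f t q2 s (shift f t q2 c j \<delta>)) i =
                (if i = j then (coeff M j + 1) mod t else coeff M i)) \<and>
         \<not> accept_bit f t q2 s verify c j \<delta>) \<and>
      (- q2 < 2 * (coeff \<nu> j + \<delta>) \<and> 2 * (coeff \<nu> j + \<delta>) \<le> 3 * q2 \<longrightarrow>
         (accept_bit f t q2 s verify c j \<delta> \<longleftrightarrow> \<delta> < \<lfloor>real_of_int q2 / 2\<rfloor> + 1 - coeff \<nu> j))) \<and>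
     (\<forall>j<n. \<forall>\<delta> \<delta>'. 0 \<le> \<delta> \<and> \<delta> \<le> \<delta>' \<and> \<delta>' \<le> q2 \<and> accept_bit f t q2 s verify c j \<delta>'
           \<longrightarrow> accept_bit f t q2 s verify c j \<delta>) \<and>
     \<comment> \<open>(ii)\<close>
     (\<forall>j<n. result (recipient f t q2 s verify) (find_noise f t q2 c j) = coeff \<nu> j) \<and>
     \<comment> \<open>(iii)\<close>
     (ring_cong f q2 (c1_q c * s) (c0_q c - \<nu>)) \<and>
     (ring_unit f q2 (c1_q c) \<longrightarrow>
           secret_residue f q2 c \<nu> = reduce f q2 s \<and>
           recovered_secret f q2 c \<nu> = s \<and>
           reduce f t (recovered_secret f q2 c \<nu>) = reduce f t s \<and>
           result (recipient f t q2 s verify) (attack f t q2 c) = (\<nu>, s)) \<and>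
     \<comment> \<open>(iv)\<close>
     (q2 < 2 ^ 32 \<and> n = 4096 \<longrightarrow>
           length (queries (recipient f t q2 s verify) (attack f t q2 c)) \<le> 4096 * 32 \<and>
           (4096 * 32 :: nat) = 131072 \<and>
           set (queries (recipient f t q2 s verify) (attack f t q2 c))
             \<subseteq> {shift f t q2 c j \<delta> | j \<delta>. j < n}) \<and>
     \<comment> \<open>(v), scalar example\<close>
     (delta_t 7 11 = 4) \<and>
     (\<forall>g. ring_modulus g 1 \<longrightarrow>
           (\<exists>d V. carries g 7 11 [:2:] d [:5:] [:1:] \<and> authenticated g 7 V [:5:] \<and>
                  ring_unit g 11 (c1_q d)) \<and>
           (\<forall>d V. carries g 7 11 [:2:] d [:5:] [:1:] \<and> authenticated g 7 V [:5:] \<longrightarrow>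
              (LEAST k::nat. \<not> accept_bit g 7 11 [:2:] V d 0 (int k)) = 5 \<and>
              result (recipient g 7 11 [:2:] V) (find_noise g 7 11 d 0) = 1 \<and>
              (ring_unit g 11 (c1_q d) \<longrightarrow>
                 result (recipient g 7 11 [:2:] V) (attack g 7 11 d) = ([:1:], [:2:])))) \<and>
     \<comment> \<open>(v), negacyclic ring with 64 coefficients\<close>
     (\<exists>q::int. odd q \<and> 2 ^ 30 \<le> q \<and> q < 2 ^ 31 \<and>
           (\<forall>p. scheme_params (negacyclic 64) 64 p q \<longrightarrow>
             (\<exists>\<sigma> d m \<mu> V. \<sigma> \<noteq> 0 \<and> \<mu> \<noteq> 0 \<and> centred (negacyclic 64) q \<sigma> \<and>
                carries (negacyclic 64) p q \<sigma> d m \<mu> \<and>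
                authenticated (negacyclic 64) p V m \<and>
                ring_unit (negacyclic 64) q (c1_q d) \<and>
                (\<forall>j. 4 * \<bar>coeff \<mu> j\<bar> \<le> q)) \<and>
             (\<forall>\<sigma> d m \<mu> V. centred (negacyclic 64) q \<sigma> \<and>
                carries (negacyclic 64) p q \<sigma> d m \<mu> \<and>
                authenticated (negacyclic 64) p V m \<and>
                ring_unit (negacyclic 64) q (c1_q d) \<and>
                (\<forall>j. 4 * \<bar>coeff \<mu> j\<bar> \<le> q) \<longrightarrow>
                result (recipient (negacyclic 64) p q \<sigma> V) (attack (negacyclic 64) p q d)
                  = (\<mu>, \<sigma>) \<and>
                (\<forall>j<64. result (recipient (negacyclic 64) p q \<sigma> V)
                           (find_noise (negacyclic 64) p q d j) = coeff \<mu> j \<and>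
                        length (queries (recipient (negacyclic 64) p q \<sigma> V)
                           (find_noise (negacyclic 64) p q d j)) = 30) \<and>
                length (queries (recipient (negacyclic 64) p q \<sigma> V)
                  (attack (negacyclic 64) p q d)) = 64 * 30)))"
proof -
  interpret captured_ciphertext f s M \<nu> n t q2 c verify
    by unfold_locales (fact params small carries auth)+
  let ?orc = "recipient f t q2 s verify"
  have base: "[q2 * delta_t_inv t q2 = 1] (mod t) \<and>
      lifted_noise f q2 s c = \<nu> \<and> decrypt f t q2 s c = M"
    using mult_delta_t_inv[OF params] lifted_noise_eq decrypt_captured by blast
  have floor: "\<lfloor>real_of_int q2 / 2\<rfloor> = q2 div 2"
    using floor_divide_of_int_eq[of q2 2] by simp
  have len: "length (queries ?orc (attack f t q2 c)) \<le> 4096 * 32" if "q2 < 2 ^ 32" "n = 4096"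
  proof -
    \<comment> \<open>Each search starts with \<open>hi - lo = q2 - 1\<close>, which is below
      \<open>2 ^ 32\<close>.\<close>
    have "length (queries ?orc (find_noise f t q2 c j)) \<le> 32" for j
      unfolding queries_find_noise using that
      by (intro length_queries_binary_search_le) simp
    then have "length (concat (map (\<lambda>j. queries ?orc (find_noise f t q2 c j)) [0..<n]))
        \<le> length [0..<n] * 32"
      by (intro length_concat_map_le)
    then show ?thesis
      using that(2) by (simp only: queries_attack degree_modulus length_upt)
  qed
  have qset: "set (queries ?orc (attack f t q2 c)) \<subseteq> {shift f t q2 c j \<delta> | j \<delta>. j < n}"
  proof
    fix e
    assume "e \<in> set (queries ?orc (attack f t q2 c))"
    then obtain j where "j < n" "e \<in> set (queries ?orc (find_noise f t q2 c j))"
      by (auto simp: queries_attack degree_modulus)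
    then show "e \<in> {shift f t q2 c j \<delta> | j \<delta>. j < n}"
      using set_queries_binary_search by (fastforce simp: queries_find_noise)
  qed
  \<comment> \<open>Modulo a monic linear \<open>g\<close> every class has a constant
    representative, so this is scalar arithmetic.\<close>
  have scalar: "(\<exists>d V. carries g 7 11 [:2:] d [:5:] [:1:] \<and> authenticated g 7 V [:5:] \<and>
          ring_unit g 11 (c1_q d)) \<and>
      (\<forall>d V. carries g 7 11 [:2:] d [:5:] [:1:] \<and> authenticated g 7 V [:5:] \<longrightarrow>
          (LEAST k::nat. \<not> accept_bit g 7 11 [:2:] V d 0 (int k)) = 5 \<and>
          result (recipient g 7 11 [:2:] V) (find_noise g 7 11 d 0) = 1 \<and>
          (ring_unit g 11 (c1_q d) \<longrightarrow>
             result (recipient g 7 11 [:2:] V) (attack g 7 11 d) = ([:1:], [:2:])))"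
    if g: "ring_modulus g 1" for g
  proof (intro conjI allI impI)
    have "coprime (7 :: int) 11"
      by (simp add: coprime_iff_gcd_eq_1 gcd_non_0_int)
    then have ps: "scheme_params g 1 7 11"
      using g by (simp add: scheme_params_def)
    have deg: "degree g = 1"
      using g by (simp add: ring_modulus_def)
    have cen: "centred g 11 [:1:]" "centred g 11 [:2:]"
      by (auto simp: centred_def deg coeff_pCons split: nat.split)
    have "reduce g 7 [:5:] = [:5:]"
      by (rule poly_eqI) (simp add: coeff_reduce_small[OF g] coeff_pCons split: nat.split)
    then show "\<exists>d V. carries g 7 11 [:2:] d [:5:] [:1:] \<and> authenticated g 7 V [:5:] \<and>
        ring_unit g 11 (c1_q d)"
      using exists_captured_ciphertext[OF ps _ cen(1)] by metis
    fix d V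
    assume "carries g 7 11 [:2:] d [:5:] [:1:] \<and> authenticated g 7 V [:5:]"
    then interpret sc: captured_ciphertext g "[:2:]" "[:5:]" "[:1:]" 1 7 11 d V
      using ps cen by unfold_locales auto
    \<comment> \<open>The threshold is \<open>11 div 2 + 1 - 1 = 5\<close>; the bits up to 5
      determine the least rejected shift.\<close>
    have acc: "accept_bit g 7 11 [:2:] V d 0 (int k) \<longleftrightarrow> k < 5" if "k \<le> 5" for k
      using sc.accept_bit_iff_nonneg[of 0 "int k"] that by simp
    show "(LEAST k::nat. \<not> accept_bit g 7 11 [:2:] V d 0 (int k)) = 5"
    proof (rule Least_equality)
      show "\<not> accept_bit g 7 11 [:2:] V d 0 (int 5)"
        using acc[of 5] by simp
      show "5 \<le> k" if "\<not> accept_bit g 7 11 [:2:] V d 0 (int k)" for k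
        using acc[of k] that by linarith
    qed
    show "result (recipient g 7 11 [:2:] V) (find_noise g 7 11 d 0) = 1"
      using sc.result_find_noise[of 0] by simp
    show "result (recipient g 7 11 [:2:] V) (attack g 7 11 d) = ([:1:], [:2:])"
      if "ring_unit g 11 (c1_q d)"
      using that by (rule sc.result_attack)
  qed
  let ?f = "negacyclic 64"
  define q :: int where "q = 2 ^ 30 + 1"
  have q: "odd q" "2 ^ 30 \<le> q" "q < 2 ^ 31"
    by (simp_all add: q_def)
  have negacyclic: "(\<exists>\<sigma> d m \<mu> V. \<sigma> \<noteq> 0 \<and> \<mu> \<noteq> 0 \<and> centred ?f q \<sigma> \<and> carries ?f p q \<sigma> d m \<mu> \<and>
          authenticated ?f p V m \<and> ring_unit ?f q (c1_q d) \<and> (\<forall>j. 4 * \<bar>coeff \<mu> j\<bar> \<le> q)) \<and>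
      (\<forall>\<sigma> d m \<mu> V. centred ?f q \<sigma> \<and> carries ?f p q \<sigma> d m \<mu> \<and> authenticated ?f p V m \<and>
          ring_unit ?f q (c1_q d) \<and> (\<forall>j. 4 * \<bar>coeff \<mu> j\<bar> \<le> q) \<longrightarrow>
          result (recipient ?f p q \<sigma> V) (attack ?f p q d) = (\<mu>, \<sigma>) \<and>
          (\<forall>j<64. result (recipient ?f p q \<sigma> V) (find_noise ?f p q d j) = coeff \<mu> j \<and>
             length (queries (recipient ?f p q \<sigma> V) (find_noise ?f p q d j)) = 30) \<and>
          length (queries (recipient ?f p q \<sigma> V) (attack ?f p q d)) = 64 * 30)"
    if ps: "scheme_params ?f 64 p q" for p
  proof (rule conjI, goal_cases)
    case 1
    have mod: "ring_modulus ?f 64"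
      using ps by (simp add: scheme_params_def)
    then have "0 < degree ?f"
      by (simp add: ring_modulus_def)
    \<comment> \<open>The witnesses are secret 1, noise 1 and plaintext 0; the quarter bound holds
      as \<open>4 \<le> q\<close>.\<close>
    then have one: "centred ?f q 1"
      by (auto simp: centred_def coeff_pCons one_pCons q_def split: nat.split)
    have bound: "4 * \<bar>coeff 1 j\<bar> \<le> q" for j
      by (auto simp: coeff_pCons one_pCons q_def split: nat.split)
    have "reduce ?f p 0 = 0"
      by (rule poly_eqI) (simp add: coeff_reduce_small[OF mod])
    from exists_captured_ciphertext[OF ps this one]
    obtain d V where "carries ?f p q 1 d 0 1" "authenticated ?f p V 0" "ring_unit ?f q (c1_q d)" .
    with one bound show ?case
      by (intro exI[of _ 1] exI[of _ d] exI[of _ 0] exI[of _ V]) auto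
  next
    case 2
    show ?case
    proof (intro allI impI, elim conjE)
      fix \<sigma> d m \<mu> V
      assume hyps: "centred ?f q \<sigma>" "carries ?f p q \<sigma> d m \<mu>" "authenticated ?f p V m"
        and unit: "ring_unit ?f q (c1_q d)" and bound: "\<forall>j. 4 * \<bar>coeff \<mu> j\<bar> \<le> q"
      interpret nc: captured_ciphertext ?f \<sigma> m \<mu> 64 p q d V
        by unfold_locales (fact ps hyps)+
      have thirty: "length (queries (recipient ?f p q \<sigma> V) (find_noise ?f p q d j)) = 30"
        if "j < 64" for j
        using nc.length_queries_find_noise[OF that q_def] bound by simp
      then have "length (concat (map (\<lambda>j. queries (recipient ?f p q \<sigma> V) (find_noise ?f p q d j))
          [0..<64])) = length [0..<64] * 30"
        by (intro length_concat_map_eq) simp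
      then have "length (queries (recipient ?f p q \<sigma> V) (attack ?f p q d)) = 64 * 30"
        by (simp only: queries_attack nc.degree_modulus length_upt)
      then show "result (recipient ?f p q \<sigma> V) (attack ?f p q d) = (\<mu>, \<sigma>) \<and>
          (\<forall>j<64. result (recipient ?f p q \<sigma> V) (find_noise ?f p q d j) = coeff \<mu> j \<and>
             length (queries (recipient ?f p q \<sigma> V) (find_noise ?f p q d j)) = 30) \<and>
          length (queries (recipient ?f p q \<sigma> V) (attack ?f p q d)) = 64 * 30"
        using nc.result_attack[OF unit] nc.result_find_noise thirty by blast
    qed
  qed
  have shifts: "\<forall>j<n. \<forall>\<delta>.
      (- q2 < 2 * (coeff \<nu> j + \<delta>) \<and> coeff \<nu> j + \<delta> \<le> q2 div 2 \<longrightarrow>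
         lifted_noise f q2 s (shift f t q2 c j \<delta>) = \<nu> + monom \<delta> j \<and>
         ring_cong f t (v_t f t s (shift f t q2 c j \<delta>) - lifted_noise f q2 s (shift f t q2 c j \<delta>))
                       (v_t f t s c - lifted_noise f q2 s c) \<and>
         decrypt f t q2 s (shift f t q2 c j \<delta>) = M \<and>
         accept_bit f t q2 s verify c j \<delta>) \<and>
      (q2 div 2 < coeff \<nu> j + \<delta> \<and> 2 * (coeff \<nu> j + \<delta>) \<le> 3 * q2 \<longrightarrow>
         lifted_noise f q2 s (shift f t q2 c j \<delta>) = \<nu> + monom (\<delta> - q2) j \<and>
         (\<forall>i. coeff (decrypt f t q2 s (shift f t q2 c j \<delta>)) i =
                (if i = j then (coeff M j + 1) mod t else coeff M i)) \<and>
         \<not> accept_bit f t q2 s verify c j \<delta>) \<and>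
      (- q2 < 2 * (coeff \<nu> j + \<delta>) \<and> 2 * (coeff \<nu> j + \<delta>) \<le> 3 * q2 \<longrightarrow>
         (accept_bit f t q2 s verify c j \<delta> \<longleftrightarrow> \<delta> < \<lfloor>real_of_int q2 / 2\<rfloor> + 1 - coeff \<nu> j))"
    unfolding floor
    by (intro allI impI conjI; (elim conjE)?)
       (fact lifted_noise_below shift_cancels_below decrypt_below accept_below
          lifted_noise_above coeff_decrypt_above reject_above accept_bit_iff)+
  have monotone: "\<forall>j<n. \<forall>\<delta> \<delta>'. 0 \<le> \<delta> \<and> \<delta> \<le> \<delta>' \<and> \<delta>' \<le> q2 \<and> accept_bit f t q2 s verify c j \<delta>'
      \<longrightarrow> accept_bit f t q2 s verify c j \<delta>"
    \<comment> \<open>Both shifts lie in \<open>{0..q2}\<close>, where the bit is a comparison with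
      one threshold.\<close>
    using accept_bit_iff_nonneg by fastforce
  have secret: "ring_unit f q2 (c1_q c) \<longrightarrow>
      secret_residue f q2 c \<nu> = reduce f q2 s \<and> recovered_secret f q2 c \<nu> = s \<and>
      reduce f t (recovered_secret f q2 c \<nu>) = reduce f t s \<and>
      result ?orc (attack f t q2 c) = (\<nu>, s)"
    using secret_residue_eq recovered_secret_eq result_attack by simp
  have count: "q2 < 2 ^ 32 \<and> n = 4096 \<longrightarrow>
      length (queries ?orc (attack f t q2 c)) \<le> 4096 * 32 \<and> (4096 * 32 :: nat) = 131072 \<and>
      set (queries ?orc (attack f t q2 c)) \<subseteq> {shift f t q2 c j \<delta> | j \<delta>. j < n}"
    using len qset by (intro impI conjI) simp_all
  have noise: "\<forall>j<n. result ?orc (find_noise f t q2 c j) = coeff \<nu> j"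
    using result_find_noise by blast
  have delta: "delta_t 7 11 = 4"
    by (simp add: delta_t_def)
  show ?thesis
    by (intro conjI[OF base] conjI[OF shifts] conjI[OF monotone] conjI[OF noise]
        conjI[OF secret_relation] conjI[OF secret] conjI[OF count] conjI[OF delta] conjI
        exI[of _ q] allI[OF impI] q scalar negacyclic)
qed

end
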